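(* Let $D$ be a countable directed set. Let $\langle \mathcal{X}_I,\mathcal{B}_I,f_{JI}\rangle_{I\preceq J\in D}$ be a projective system of Polish measurable spaces with projective limit $(\mathcal{X}_D,\mathcal{B}_D)$ and canonical maps $f_I:\mathcal{X}_D\to\mathcal{X}_I$. Let $\langle P_I[X_I|\mathcal{C}_I]\rangle_{I\in D}$ be a projective family of probability kernels (regular conditional probabilities) on this system, where $X_I:\Omega\to\mathcal{X}_I$ are random variables and $\langle\mathcal{C}_I\rangle_{I\in D}$ is a directed family of $\sigma$-subalgebras of $\mathcal{A}$. Then there exists a unique (up to equivalence) probability kernel $P_D[\,\cdot\,|\mathcal{C}_D]:\mathcal{B}_D\times\Omega\to[0,1]$ which satisfies $$(f_I P_D)[\,\cdot\,|\mathcal{C}_D] =_{\text{a.e.}} P_I[\,\cdot\,|\mathcal{C}_I]\qquad\text{for all } I\in D$$ and is measurable (in its second argument) with respect to $\mathcal{C}_D:=\sigma(\mathcal{C}_I; I\in D)$.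
   Context: $(\Omega,\mathcal{A},\mathbb{P})$ is an abstract probability space, the common domain of all random variables; a.e. refers to $\mathbb{P}$. Projective system: $(D,\preceq)$ is a partially ordered directed set; for each $I\in D$, $\mathcal{X}_I$ is a Polish space with Borel $\sigma$-algebra $\mathcal{B}_I$, and for $I\preceq J$ the map $f_{JI}:\mathcal{X}_J\to\mathcal{X}_I$ is continuous, with $f_{II}=\mathrm{Id}$ and $f_{KI}=f_{JI}\circ f_{KJ}$ whenever $I\preceq J\preceq K$. The projective limit $\mathcal{X}_D$ is the set of all $(x_I)_{I\in D}\in\prod_I\mathcal{X}_I$ with $x_I=f_{JI}x_J$ whenever $I\preceq J$; $f_I$ is the map $(x_J)_J\mapsto x_I$; $\mathcal{X}_D$ carries the coarsest topology making all $f_I$ continuous, and $\mathcal{B}_D$ is its Borel $\sigma$-algebra. $P_I[\,\cdot\,|\mathcal{C}_I](\,\cdot\,):\mathcal{B}_I\times\Omega\to[0,1]$ is the regular conditional probability of $X_I$ given $\mathcal{C}_I$. The family $\langle\mathcal{C}_I\rangle$ is directed if $\mathcal{C}_I\subset\mathcal{C}_J$ whenever $I\preceq J$. Maps act on the first argument of kernels: $(f_{JI}P_J)[A|\mathcal{C}_J](\omega):=P_J[f_{JI}^{-1}A|\mathcal{C}_J](\omega)$, and similarly for $f_I$. The family of kernels is projective if $(f_{JI}P_J)[\,\cdot\,|\mathcal{C}_J]=_{\text{a.e.}}P_I[\,\cdot\,|\mathcal{C}_I]$ whenever $I\preceq J$. For kernels, $=_{\text{a.e.}}$ (and equivalence)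 means equality as measures for $\mathbb{P}$-almost every $\omega$. *)

theory Defs
  imports "HOL-Probability.Probability"
begin

definition polish_topology :: "'a topology \<Rightarrow> bool" where
  "polish_topology X \<longleftrightarrow> completely_metrizable_space X \<and> separable_space X"

definition borel_of :: "'a topology \<Rightarrow> 'a measure" where
  "borel_of X = sigma (topspace X) {U. openin X U}"

lemma space_borel_of [simp]: "space (borel_of X) = topspace X"
  by (simp add: borel_of_def space_measure_of_conv)

lemma sets_borel_of: "sets (borel_of X) = sigma_sets (topspace X) {U. openin X U}"
  unfolding borel_of_def by (rule sets_measure_of) (auto dest: openin_subset)

lemma measurable_borel_of_continuous:
  assumes "continuous_map X Y f"
  shows "f \<in> borel_of X \<rightarrow>\<^sub>M borel_of Y"
proof -
  have "f \<in> borel_of X \<rightarrow>\<^sub>M sigma (topspace Y) {U. openin Y U}"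
  proof (rule measurable_measure_of)
    show "{U. openin Y U} \<subseteq> Pow (topspace Y)"
      by (auto dest: openin_subset)
    show "f \<in> space (borel_of X) \<rightarrow> topspace Y"
      using assms by (simp add: continuous_map_def)
    show "f -` U \<inter> space (borel_of X) \<in> sets (borel_of X)" if "U \<in> {U. openin Y U}" for U
    proof -
      have "openin X {x \<in> topspace X. f x \<in> U}"
        using assms that by (simp add: continuous_map_def)
      moreover have "f -` U \<inter> topspace X = {x \<in> topspace X. f x \<in> U}"
        by auto
      ultimately show ?thesis
        by (auto simp: sets_borel_of)
    qed
  qed
  then show ?thesis
    by (simp add: borel_of_def[of Y])
qed

text \<open>
  The order on the index set \<open>D\<close> is the relation \<open>r\<close>: \<open>(I, J) \<in> r\<close> means that \<open>I\<close> precedes \<open>J\<close>.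
  The bonding map from \<open>X J\<close> to \<open>X I\<close> is written \<open>f J I\<close>. The spaces \<open>X I\<close> may be
  unrelated to each other; the common type \<open>'a\<close> only serves as a universe for their points.
\<close>

locale projective_system =
  fixes D :: "'i set" and r :: "('i \<times> 'i) set"
    and X :: "'i \<Rightarrow> 'a topology" and f :: "'i \<Rightarrow> 'i \<Rightarrow> 'a \<Rightarrow> 'a"
  assumes partial_order: "partial_order_on D r"
    and nonempty: "D \<noteq> {}"
    and directed: "\<And>I J. I \<in> D \<Longrightarrow> J \<in> D \<Longrightarrow> \<exists>K\<in>D. (I, K) \<in> r \<and> (J, K) \<in> r"
    and polish: "\<And>I. I \<in> D \<Longrightarrow> polish_topology (X I)"
    and continuous: "\<And>I J. (I, J) \<in> r \<Longrightarrow> continuous_map (X J) (X I) (f J I)"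
    and ident: "\<And>I x. I \<in> D \<Longrightarrow> x \<in> topspace (X I) \<Longrightarrow> f I I x = x"
    and compose: "\<And>I J K x. (I, J) \<in> r \<Longrightarrow> (J, K) \<in> r \<Longrightarrow> x \<in> topspace (X K) \<Longrightarrow>
      f K I x = f J I (f K J x)"

definition proj_limit_set ::
    "'i set \<Rightarrow> ('i \<times> 'i) set \<Rightarrow> ('i \<Rightarrow> 'a topology) \<Rightarrow> ('i \<Rightarrow> 'i \<Rightarrow> 'a \<Rightarrow> 'a) \<Rightarrow> ('i \<Rightarrow> 'a) set" where
  "proj_limit_set D r X f =
    {x \<in> (\<Pi>\<^sub>E I\<in>D. topspace (X I)). \<forall>(I, J)\<in>r. x I = f J I (x J)}"

definition proj_limit ::
    "'i set \<Rightarrow> ('i \<times> 'i) set \<Rightarrow> ('i \<Rightarrow> 'a topology) \<Rightarrow> ('i \<Rightarrow> 'i \<Rightarrow> 'a \<Rightarrow> 'a) \<Rightarrow> ('i \<Rightarrow> 'a) topology" where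
  "proj_limit D r X f = topology_generated_by
    {{x \<in> proj_limit_set D r X f. x I \<in> U} | I U. I \<in> D \<and> openin (X I) U}"

lemma topspace_proj_limit:
  assumes "D \<noteq> {}"
  shows "topspace (proj_limit D r X f) = proj_limit_set D r X f"
proof -
  obtain I where I: "I \<in> D" using assms by blast
  have "proj_limit_set D r X f = {x \<in> proj_limit_set D r X f. x I \<in> topspace (X I)}"
    using I by (auto simp: proj_limit_set_def PiE_iff)
  then have "proj_limit_set D r X f
      \<in> {{x \<in> proj_limit_set D r X f. x I \<in> U} | I U. I \<in> D \<and> openin (X I) U}"
    using I by blast
  then show ?thesis
    unfolding proj_limit_def topology_generated_by_topspace by blast
qed

lemma continuous_map_proj_limit:
  assumes "I \<in> D"
  shows "continuous_map (proj_limit D r X f) (X I) (\<lambda>x. x I)"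
proof -
  have D: "D \<noteq> {}" using assms by blast
  show ?thesis
    unfolding continuous_map_def topspace_proj_limit[OF D]
  proof (intro conjI allI impI)
    show "(\<lambda>x. x I) \<in> proj_limit_set D r X f \<rightarrow> topspace (X I)"
      using assms by (auto simp: proj_limit_set_def PiE_iff)
    show "openin (proj_limit D r X f) {x \<in> proj_limit_set D r X f. x I \<in> U}"
      if "openin (X I) U" for U
      unfolding proj_limit_def by (rule topology_generated_by_Basis) (use assms that in blast)
  qed
qed

text \<open>
  A probability kernel is a map \<open>\<kappa>\<close> from points of the sample space to probability measures
  that is measurable into the Giry space \<open>prob_algebra\<close>, that is, \<open>measure (\<kappa> \<omega>) A\<close> is
  measurable in \<open>\<omega>\<close> for every measurable \<open>A\<close>.
\<close>

definition regular_cond_prob ::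
    "'w measure \<Rightarrow> 'w measure \<Rightarrow> 'b measure \<Rightarrow> ('w \<Rightarrow> 'b) \<Rightarrow> ('w \<Rightarrow> 'b measure) \<Rightarrow> bool" where
  "regular_cond_prob M C N Y \<kappa> \<longleftrightarrow>
    \<kappa> \<in> C \<rightarrow>\<^sub>M prob_algebra N \<and>
    (\<forall>A\<in>sets N. AE \<omega> in M.
      measure (\<kappa> \<omega>) A = real_cond_exp M C (indicator (Y -` A \<inter> space M)) \<omega>)"

definition limit_kernel ::
    "'w measure \<Rightarrow> ('i \<Rightarrow> 'w measure) \<Rightarrow> 'i set \<Rightarrow> ('i \<times> 'i) set \<Rightarrow> ('i \<Rightarrow> 'a topology) \<Rightarrow>
     ('i \<Rightarrow> 'i \<Rightarrow> 'a \<Rightarrow> 'a) \<Rightarrow> ('i \<Rightarrow> 'w \<Rightarrow> 'a measure) \<Rightarrow> ('w \<Rightarrow> ('i \<Rightarrow> 'a) measure) \<Rightarrow> bool" where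
  "limit_kernel M C D r X f P \<kappa> \<longleftrightarrow>
    \<kappa> \<in> sigma (space M) (\<Union>I\<in>D. sets (C I)) \<rightarrow>\<^sub>M prob_algebra (borel_of (proj_limit D r X f)) \<and>
    (\<forall>I\<in>D. AE \<omega> in M. distr (\<kappa> \<omega>) (borel_of (X I)) (\<lambda>x. x I) = P I \<omega>)"

end

theory Submission
  imports Defs
begin

text \<open>
  For a fixed \<open>\<omega>\<close> at which the measures \<open>P I \<omega>\<close> are consistent, that is, at which
  \<open>distr (P J \<omega>) _ (f J I) = P I \<omega>\<close> holds for all pairs in the order, a measure on the projective limit
  with these marginals is what Kolmogorov's extension theorem provides. Since \<open>D\<close> is countable, the
  consistency conditions are countably many almost sure statements, so they hold simultaneously
  outside one null set. It remains to see that the choice can be made measurably.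
  
  Existence for one consistent family (\<open>proj_limit_measure_exists\<close>). The Daniell-Kolmogorov theorem is
  about product spaces over a polish type, so each \<open>X I\<close> is realised as a Borel retract of
  \<open>nat \<Rightarrow> real\<close>: there are Borel maps \<open>e\<close> into \<open>nat \<Rightarrow> real\<close> and \<open>g\<close> back, with \<open>g (e x) = x\<close>
  (\<open>polish_topology_measurable_retract\<close>). For a finite set \<open>F\<close> of indices, any upper bound \<open>K\<close> of \<open>F\<close>
  yields a joint law of the points \<open>e I (f K I x)\<close>, \<open>I \<in> F\<close>, where \<open>x\<close> has law \<open>P K \<omega>\<close>; consistency makes
  it independent of \<open>K\<close>, and these laws form a projective family. Under their limit on the product,
  almost every point is carried by the maps \<open>g I\<close> to a compatible thread, because each of the
  countably many thread equations concerns only two coordinates. The image measure is the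
  required one.
  
  Uniqueness and measurability both come from the cylinders \<open>{x. x I \<in> A}\<close>. By directedness, two
  cylinders are cylinders over a common index, so they are closed under intersection; by countability
  of \<open>D\<close> they generate the Borel sets of the limit (\<open>sets_proj_limit\<close>). A probability measure on the limit is
  therefore determined by its marginals. For the same reason a choice of limit measures is a kernel
  as soon as it is measurable on cylinders, where it agrees with some \<open>P I\<close>.
  
  The set of consistent \<open>\<omega>\<close> belongs to the \<open>\<sigma>\<close>-algebra generated by the \<open>C I\<close>, since the set on which two
  kernels into a Polish space coincide is measurable (\<open>measurable_eq_prob_kernels\<close>). Off this set the
  kernel takes its value at one fixed consistent point.
\<close>

section \<open>Polish spaces as Borel retracts of a sequence space\<close>

text \<open>
  With a complete metric \<open>d\<close> and a dense sequence \<open>a\<close>, let \<open>e x\<close> be the sequence of distances \<open>d x (a n)\<close>.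
  The image of \<open>e\<close> is Borel because it has an explicit description: it consists of the sequences \<open>y\<close>
  that satisfy the triangle inequalities of a distance to a point, and that have infimum zero. Indeed, points \<open>a i\<close>
  with \<open>y i\<close> tending to zero form a Cauchy sequence, and the distances to its limit are the entries of \<open>y\<close>. The inverse
  of \<open>e\<close> is Borel because a ball around \<open>a n\<close> corresponds to a bound on the coordinate \<open>y n\<close>. Extending it by a
  constant off the image makes \<open>g\<close> total, so that later constructions need not mention the image.
\<close>

lemma polish_topology_measurable_retract:
  fixes X :: "'a topology"
  assumes "polish_topology X" and ne: "topspace X \<noteq> {}"
  obtains e :: "'a \<Rightarrow> nat \<Rightarrow> real" and g :: "(nat \<Rightarrow> real) \<Rightarrow> 'a"
  where "e \<in> borel_of X \<rightarrow>\<^sub>M borel" "g \<in> borel \<rightarrow>\<^sub>M borel_of X"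
    "\<And>x. x \<in> topspace X \<Longrightarrow> g (e x) = x"
proof -
  obtain M d where "Metric_space M d" and complete: "Metric_space.mcomplete M d"
    and X: "X = Metric_space.mtopology M d"
    using assms by (auto simp: polish_topology_def completely_metrizable_space_def)
  then interpret Metric_space M d by simp
  have XM: "topspace X = M" by (simp add: X)
  obtain S where S: "countable S" "S \<subseteq> M" "X closure_of S = topspace X"
    using assms by (auto simp: polish_topology_def separable_space_def XM)
  have "S \<noteq> {}" using S(3) ne by (metis closure_of_empty)
  define a where "a = from_nat_into S"
  have aS: "range a = S"
    unfolding a_def using \<open>S \<noteq> {}\<close> S(1) by (rule range_from_nat_into)
  have a[simp]: "a n \<in> M" for n using aS S(2) by auto
  have dense: "\<exists>n. d x (a n) < \<epsilon>" if "x \<in> M" "\<epsilon> > 0" for x \<epsilon>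
  proof -
    have "openin X (mball x \<epsilon>)" "x \<in> mball x \<epsilon>"
      using that by (auto simp: X)
    then have "S \<inter> mball x \<epsilon> \<noteq> {}"
      using S(3) unfolding dense_intersects_open by blast
    then show ?thesis using aS by auto
  qed
  define e where "e x n = d x (a n)" for x n
  define R :: "(nat \<Rightarrow> real) set" where
    "R = {y. (\<forall>i j. d (a i) (a j) \<le> y i + y j \<and> \<bar>y i - y j\<bar> \<le> d (a i) (a j)) \<and>
      (\<forall>k. \<exists>i. y i < 1 / Suc k)}"
  have R[measurable]: "R \<in> sets borel"
    unfolding R_def by measurable
  have onto: "\<exists>x. x \<in> M \<and> e x = y" if "y \<in> R" for y
  proof -
    have tri: "d (a i) (a j) \<le> y i + y j" and lip: "\<bar>y i - y j\<bar> \<le> d (a i) (a j)"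
      and small: "\<exists>i. y i < 1 / Suc k" for i j k
      using that by (auto simp: R_def)
    (* the points a (s k) approach the point sought, at rate 1 / Suc k *)
    obtain s where s: "y (s k) < 1 / Suc k" for k
      using small by metis
    have "MCauchy (a \<circ> s)"
      unfolding MCauchy_def
    proof (intro conjI allI impI)
      fix \<epsilon> :: real assume "\<epsilon> > 0"
      then obtain N where N: "1 / Suc N < \<epsilon> / 2"
        using nat_approx_posE[of "\<epsilon>/2"] by auto
      have "d ((a \<circ> s) n) ((a \<circ> s) n') < \<epsilon>" if "N \<le> n" "N \<le> n'" for n n'
      proof -
        have "1 / Suc n \<le> 1 / Suc N" "1 / Suc n' \<le> 1 / Suc N"
          using that by (auto simp: frac_le)
        then show ?thesis
          using tri[of "s n" "s n'"] s[of n] s[of n'] N by simp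
      qed
      then show "\<exists>N. \<forall>n n'. N \<le> n \<longrightarrow> N \<le> n' \<longrightarrow> d ((a \<circ> s) n) ((a \<circ> s) n') < \<epsilon>" by blast
    qed auto
    then obtain x where x: "limitin mtopology (a \<circ> s) x sequentially"
      using complete unfolding mcomplete_def by blast
    then have "x \<in> M" by (simp add: limit_metric_sequentially)
    moreover have "e x n = y n" for n
    proof -
      have "\<bar>e x n - y n\<bar> \<le> \<epsilon>" if "\<epsilon> > 0" for \<epsilon>
      proof -
        obtain N where N: "\<And>k. k \<ge> N \<Longrightarrow> d (a (s k)) x < \<epsilon> / 2"
          using x \<open>\<epsilon> > 0\<close> unfolding limit_metric_sequentially o_def by (meson half_gt_zero)
        obtain N' where N': "1 / Suc N' < \<epsilon> / 2"
          using nat_approx_posE[of "\<epsilon>/2"] \<open>\<epsilon> > 0\<close> by auto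
        define k where "k = max N N'"
        have "1 / Suc k \<le> 1 / Suc N'" by (auto simp: k_def frac_le)
        then have "y (s k) < \<epsilon> / 2" using s[of k] N' by linarith
        moreover have "d (a (s k)) x < \<epsilon> / 2" using N by (simp add: k_def)
        moreover have "d (a (s k)) (a n) \<le> y (s k) + y n" "\<bar>y (s k) - y n\<bar> \<le> d (a (s k)) (a n)"
          using tri lip by auto
        moreover have "\<bar>d x (a n) - d (a n) (a (s k))\<bar> \<le> d x (a (s k))"
          using mdist_reverse_triangle \<open>x \<in> M\<close> a by blast
        ultimately show ?thesis
          by (simp add: e_def commute abs_le_iff)
      qed
      then show ?thesis
        by (metis abs_le_zero_iff dense_ge eq_iff_diff_eq_0)
    qed
    ultimately show ?thesis by auto
  qed
  have eR: "e x \<in> R" if "x \<in> M" for x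
    unfolding R_def
  proof (intro CollectI conjI allI)
    fix i j k
    show "d (a i) (a j) \<le> e x i + e x j"
      using triangle[of "a i" x "a j"] that by (simp add: e_def commute)
    show "\<bar>e x i - e x j\<bar> \<le> d (a i) (a j)"
      using mdist_reverse_triangle[of "a i" x "a j"] that by (simp add: e_def commute)
    show "\<exists>i. e x i < 1 / Suc k"
      using dense[OF that, of "1 / Suc k"] by (simp add: e_def)
  qed
  have inj: "x = x'" if "x \<in> M" "x' \<in> M" "e x = e x'" for x x'
  proof (rule ccontr)
    assume "x \<noteq> x'"
    then have "d x x' / 2 > 0" using that by simp
    then obtain n where n: "d x (a n) < d x x' / 2" using dense[OF \<open>x \<in> M\<close>] by blast
    moreover have "d x' (a n) = d x (a n)" using fun_cong[OF that(3), of n] by (simp add: e_def)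
    moreover have "d x x' \<le> d x (a n) + d (a n) x'" using triangle that a by blast
    ultimately show False by (simp add: commute)
  qed
  define g where "g y = (if y \<in> R then SOME x. x \<in> M \<and> e x = y else a 0)" for y
  have gR: "g y \<in> M" "e (g y) = y" if "y \<in> R" for y
    using someI_ex[OF onto[OF that]] that by (simp_all add: g_def)
  have gM: "g y \<in> M" for y
    using gR(1)[of y] by (cases "y \<in> R") (auto simp: g_def)
  show thesis
  proof
    show "e \<in> borel_of X \<rightarrow>\<^sub>M borel"
    proof (rule measurable_coordinatewise_then_product)
      fix n
      have "continuous_map X euclideanreal (\<lambda>x. d x (a n))"
        unfolding continuous_map_def
      proof (intro conjI allI impI)
        fix U :: "real set" assume U: "openin euclideanreal U"
        show "openin X {x \<in> topspace X. d x (a n) \<in> U}"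
          unfolding X openin_mtopology
        proof (intro conjI allI impI)
          fix x assume "x \<in> {x \<in> topspace mtopology. d x (a n) \<in> U}"
          then have x: "x \<in> M" "d x (a n) \<in> U" by auto
          then obtain \<epsilon> where "\<epsilon> > 0" and \<epsilon>: "\<And>t. dist t (d x (a n)) < \<epsilon> \<Longrightarrow> t \<in> U"
            using U by (auto simp: open_dist)
          have "mball x \<epsilon> \<subseteq> {x \<in> topspace mtopology. d x (a n) \<in> U}"
          proof
            fix z assume z: "z \<in> mball x \<epsilon>"
            then have "\<bar>d z (a n) - d (a n) x\<bar> \<le> d z x"
              using mdist_reverse_triangle x by auto
            then show "z \<in> {x \<in> topspace mtopology. d x (a n) \<in> U}"
              using z by (auto intro!: \<epsilon> simp: dist_real_def commute)
          qed
          then show "\<exists>r>0. mball x r \<subseteq> {x \<in> topspace mtopology. d x (a n) \<in> U}"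
            using \<open>\<epsilon> > 0\<close> by blast
        qed auto
      qed auto
      then have "(\<lambda>x. d x (a n)) \<in> borel_of X \<rightarrow>\<^sub>M borel_of euclideanreal"
        by (rule measurable_borel_of_continuous)
      then show "(\<lambda>x. e x n) \<in> borel_measurable (borel_of X)"
        by (simp add: e_def borel_of_def borel_def)
    qed
    show "g \<in> borel \<rightarrow>\<^sub>M borel_of X"
    proof (rule measurable_sigma_sets[OF sets_borel_of])
      fix U assume "U \<in> {U. openin X U}"
      then have U: "openin X U" by simp
      have "g y \<in> U \<longleftrightarrow> (\<exists>n k. mball (a n) (1 / Suc k) \<subseteq> U \<and> y n < 1 / Suc k)" if "y \<in> R" for y
      proof
        assume "g y \<in> U"
        then obtain r where r: "r > 0" "mball (g y) r \<subseteq> U"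
          using U by (auto simp: X openin_mtopology)
        obtain k where k: "1 / Suc k < r / 2"
          using nat_approx_posE[of "r/2"] r by auto
        obtain n where n: "d (g y) (a n) < 1 / Suc k"
          using dense[OF gM, of "1 / Suc k" y] by auto
        have "mball (a n) (1 / Suc k) \<subseteq> mball (g y) r"
        proof
          fix z assume "z \<in> mball (a n) (1 / Suc k)"
          then show "z \<in> mball (g y) r"
            using triangle[of "g y" "a n" z] gM[of y] n k by auto
        qed
        moreover have "y n = d (g y) (a n)"
          using fun_cong[OF gR(2)[OF that], of n] by (simp add: e_def)
        ultimately show "\<exists>n k. mball (a n) (1 / Suc k) \<subseteq> U \<and> y n < 1 / Suc k"
          using n r(2) by (metis order_trans)
      next
        assume "\<exists>n k. mball (a n) (1 / Suc k) \<subseteq> U \<and> y n < 1 / Suc k"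
        then obtain n k where "mball (a n) (1 / Suc k) \<subseteq> U" "y n < 1 / Suc k" by blast
        moreover have "y n = d (g y) (a n)"
          using fun_cong[OF gR(2)[OF that], of n] by (simp add: e_def)
        ultimately show "g y \<in> U"
          using gM[of y] by (auto simp: commute)
      qed
      (* a countable union, since only balls with centre a n and radius 1 / Suc k occur *)
      then have "y \<in> g -` U \<longleftrightarrow> (if y \<in> R then \<exists>n k. mball (a n) (1 / Suc k) \<subseteq> U \<and> y n < 1 / Suc k else a 0 \<in> U)" for y
        by (cases "y \<in> R") (simp, simp add: g_def)
      then have "g -` U \<inter> space borel =
        {y. if y \<in> R then \<exists>n k. mball (a n) (1 / Suc k) \<subseteq> U \<and> y n < 1 / Suc k else a 0 \<in> U}"
        by (simp only: set_eq_iff Int_iff space_borel UNIV_I simp_thms mem_Collect_eq)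
      also have "\<dots> \<in> sets borel"
        by measurable
      finally show "g -` U \<inter> space borel \<in> sets borel" .
    next
      show "{U. openin X U} \<subseteq> Pow (topspace X)" using openin_subset by blast
    qed (simp add: XM gM)
    show "g (e x) = x" if "x \<in> topspace X" for x
      using that gR[OF eR] inj by (simp add: XM)
  qed
qed

section \<open>Equality sets of kernels\<close>

text \<open>
  Finite intersections of a countable basis. This reduces equality of two measures to countably many
  equations, whence the measurability of equality sets below.
\<close>

lemma second_countable_borel_countable_generator:
  obtains G :: "'b::second_countable_topology set set"
  where "countable G" "Int_stable G" "UNIV \<in> G" "sets borel = sigma_sets UNIV G"
proof -
  obtain B :: "'b set set" where B: "countable B" "topological_basis B"
    using ex_countable_basis by blast
  define G where "G = Inter ` {F. finite F \<and> F \<subseteq> B}"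
  have "countable G"
    unfolding G_def using B(1) by (intro countable_image countable_Collect_finite_subset)
  moreover have "Int_stable G"
  proof (rule Int_stableI)
    fix U V assume "U \<in> G" "V \<in> G"
    then obtain E F where "finite E" "E \<subseteq> B" "U = \<Inter>E" "finite F" "F \<subseteq> B" "V = \<Inter>F"
      by (auto simp: G_def)
    then show "U \<inter> V \<in> G"
      unfolding G_def by (intro image_eqI[of _ _ "E \<union> F"]) auto
  qed
  moreover have "UNIV \<in> G"
    unfolding G_def by (intro image_eqI[of _ _ "{}"]) auto
  moreover have "sets borel = sigma_sets UNIV G"
  proof
    have "B \<subseteq> G"
      unfolding G_def by (auto intro!: image_eqI[of _ Inter "{U}" for U])
    then show "sets borel \<subseteq> sigma_sets UNIV G"
      unfolding borel_eq_countable_basis[OF B]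
      by (simp add: sigma_sets_mono')
    have "open U" if "U \<in> G" for U
      using that topological_basis_open[OF B(2)] by (auto simp: G_def intro!: open_Inter)
    then show "sigma_sets UNIV G \<subseteq> sets borel"
      by (metis borel_open sets.sigma_sets_subset space_borel subsetI)
  qed
  ultimately show thesis by (rule that)
qed

lemma measurable_eq_prob_kernels_borel:
  fixes K L :: "'w \<Rightarrow> 'b::second_countable_topology measure"
  assumes K: "K \<in> C \<rightarrow>\<^sub>M prob_algebra borel" and L: "L \<in> C \<rightarrow>\<^sub>M prob_algebra borel"
  shows "{\<omega> \<in> space C. K \<omega> = L \<omega>} \<in> sets C"
proof -
  obtain G :: "'b set set" where G: "countable G" "Int_stable G" "UNIV \<in> G" "sets borel = sigma_sets UNIV G"
    by (rule second_countable_borel_countable_generator)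
  have GB: "A \<in> sets borel" if "A \<in> G" for A
    using that G(4) by auto
  have eq: "K \<omega> = L \<omega> \<longleftrightarrow> (\<forall>A\<in>G. emeasure (K \<omega>) A = emeasure (L \<omega>) A)" if "\<omega> \<in> space C" for \<omega>
  proof
    assume *: "\<forall>A\<in>G. emeasure (K \<omega>) A = emeasure (L \<omega>) A"
    have "prob_space (K \<omega>)" "sets (K \<omega>) = sets borel" "sets (L \<omega>) = sets borel"
      using measurable_space[OF K that] measurable_space[OF L that] by (auto simp: space_prob_algebra)
    then show "K \<omega> = L \<omega>"
      using G * by (intro measure_eqI_generator_eq[where E=G and \<Omega>=UNIV and A="\<lambda>_. UNIV"])
        (auto simp: finite_measure.emeasure_finite prob_space.finite_measure)
  qed simp
  have [measurable]: "(\<lambda>\<omega>. emeasure (K \<omega>) A) \<in> borel_measurable C"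
      "(\<lambda>\<omega>. emeasure (L \<omega>) A) \<in> borel_measurable C" if "A \<in> G" for A
    using GB[OF that] measurable_prob_algebraD[OF K] measurable_prob_algebraD[OF L]
    by (auto intro: measurable_emeasure_kernel)
  have "{\<omega> \<in> space C. K \<omega> = L \<omega>} = {\<omega> \<in> space C. \<forall>A\<in>G. emeasure (K \<omega>) A = emeasure (L \<omega>) A}"
    using eq by auto
  also have "\<dots> \<in> sets C"
    using G(1) by measurable
  finally show ?thesis .
qed

text \<open>
  The retraction transports the claim to \<open>nat \<Rightarrow> real\<close>: a measure on \<open>X\<close> is recovered from its image under
  \<open>e\<close> by applying \<open>g\<close>.
\<close>

lemma measurable_eq_prob_kernels:
  assumes X: "polish_topology X"
    and K: "K \<in> C \<rightarrow>\<^sub>M prob_algebra (borel_of X)" and L: "L \<in> C \<rightarrow>\<^sub>M prob_algebra (borel_of X)"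
  shows "{\<omega> \<in> space C. K \<omega> = L \<omega>} \<in> sets C"
proof (cases "space C = {}")
  case False
  then obtain \<omega> where "\<omega> \<in> space C" by blast
  then have "prob_space (K \<omega>)" "sets (K \<omega>) = sets (borel_of X)"
    using measurable_space[OF K] by (auto simp: space_prob_algebra)
  then have "topspace X \<noteq> {}"
    by (metis prob_space.not_empty sets_eq_imp_space_eq space_borel_of)
  then obtain e :: "'a \<Rightarrow> nat \<Rightarrow> real" and g where e: "e \<in> borel_of X \<rightarrow>\<^sub>M borel"
    and g: "g \<in> borel \<rightarrow>\<^sub>M borel_of X" and ge: "\<And>x. x \<in> topspace X \<Longrightarrow> g (e x) = x"
    by (rule polish_topology_measurable_retract[OF X]) blast
  have inv: "distr (distr \<mu> borel e) (borel_of X) g = \<mu>" if "\<mu> \<in> space (prob_algebra (borel_of X))" for \<mu>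
  proof -
    have s: "sets \<mu> = sets (borel_of X)" using that by (simp add: space_prob_algebra)
    then have "distr (distr \<mu> borel e) (borel_of X) g = distr \<mu> (borel_of X) (g \<circ> e)"
      using e g measurable_cong_sets[OF s refl] by (intro distr_distr) auto
    also have "\<dots> = distr \<mu> \<mu> (\<lambda>x. x)"
      using s sets_eq_imp_space_eq[OF s] ge by (intro distr_cong) auto
    finally show ?thesis by simp
  qed
  have "K \<omega> = L \<omega> \<longleftrightarrow> distr (K \<omega>) borel e = distr (L \<omega>) borel e" if "\<omega> \<in> space C" for \<omega>
    using inv[OF measurable_space[OF K that]] inv[OF measurable_space[OF L that]] by metis
  then have "{\<omega> \<in> space C. K \<omega> = L \<omega>} = {\<omega> \<in> space C. distr (K \<omega>) borel e = distr (L \<omega>) borel e}"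
    by auto
  also have "\<dots> \<in> sets C"
    using measurable_compose[OF K measurable_distr_prob_space[OF e]]
      measurable_compose[OF L measurable_distr_prob_space[OF e]]
    by (intro measurable_eq_prob_kernels_borel)
  finally show ?thesis .
qed simp

section \<open>Cylinders in the projective limit\<close>

context projective_system
begin

lemma index_order:
  shows "r \<subseteq> D \<times> D" and "I \<in> D \<Longrightarrow> (I, I) \<in> r"
    and "(I, J) \<in> r \<Longrightarrow> (J, K) \<in> r \<Longrightarrow> (I, K) \<in> r"
  using partial_order
  by (auto simp: partial_order_on_def preorder_on_def refl_on_def dest: transD)

lemma measurable_bonding: "(I, J) \<in> r \<Longrightarrow> f J I \<in> borel_of (X J) \<rightarrow>\<^sub>M borel_of (X I)"
  by (intro measurable_borel_of_continuous continuous)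

lemma bonding_in_topspace: "(I, J) \<in> r \<Longrightarrow> x \<in> topspace (X J) \<Longrightarrow> f J I x \<in> topspace (X I)"
  using continuous by (auto simp: continuous_map_def)

definition cylinder :: "'i \<Rightarrow> 'a set \<Rightarrow> ('i \<Rightarrow> 'a) set" where
  "cylinder I A = {x \<in> proj_limit_set D r X f. x I \<in> A}"

definition cylinders :: "('i \<Rightarrow> 'a) set set" where
  "cylinders = {cylinder I A | I A. I \<in> D \<and> A \<in> sets (borel_of (X I))}"

lemma proj_limitD:
  assumes "x \<in> proj_limit_set D r X f"
  shows "I \<in> D \<Longrightarrow> x I \<in> topspace (X I)" and "(I, J) \<in> r \<Longrightarrow> x I = f J I (x J)"
  using assms by (auto simp: proj_limit_set_def)

lemma cylinder_topspace: "I \<in> D \<Longrightarrow> cylinder I (topspace (X I)) = proj_limit_set D r X f"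
  by (auto simp: cylinder_def proj_limitD)

lemma cylinder_Int:
  assumes "(I, K) \<in> r" "(J, K) \<in> r"
  shows "cylinder I A \<inter> cylinder J B =
    cylinder K ((f K I -` A \<inter> topspace (X K)) \<inter> (f K J -` B \<inter> topspace (X K)))"
proof -
  have "K \<in> D" using assms index_order(1) by auto
  then show ?thesis
    using assms by (auto simp: cylinder_def proj_limitD)
qed

text \<open>
  Two cylinders are pulled back to a common upper bound of their indices.
\<close>

lemma Int_stable_cylinders: "Int_stable cylinders"
proof (rule Int_stableI)
  fix U V assume "U \<in> cylinders" "V \<in> cylinders"
  then obtain I J A B where U: "U = cylinder I A" "I \<in> D" "A \<in> sets (borel_of (X I))"
    and V: "V = cylinder J B" "J \<in> D" "B \<in> sets (borel_of (X J))"
    by (auto simp: cylinders_def)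
  obtain K where K: "K \<in> D" "(I, K) \<in> r" "(J, K) \<in> r"
    using directed U V by blast
  have "f K I -` A \<inter> topspace (X K) \<in> sets (borel_of (X K))"
    "f K J -` B \<inter> topspace (X K) \<in> sets (borel_of (X K))"
    using measurable_sets[OF measurable_bonding[OF K(2)] U(3)]
      measurable_sets[OF measurable_bonding[OF K(3)] V(3)] by auto
  then show "U \<inter> V \<in> cylinders"
    unfolding U V cylinder_Int[OF K(2,3)] cylinders_def using K(1) by blast
qed

lemma cylinders_subset: "cylinders \<subseteq> Pow (proj_limit_set D r X f)"
  by (auto simp: cylinders_def cylinder_def)

text \<open>
  The sets that define the topology are a subbasis; directedness makes them a basis.
\<close>

lemma open_contains_cylinder:
  assumes "openin (proj_limit D r X f) W" "x \<in> W"
  shows "\<exists>I\<in>D. \<exists>U. openin (X I) U \<and> x \<in> cylinder I U \<and> cylinder I U \<subseteq> W"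
proof -
  let ?S = "{{x \<in> proj_limit_set D r X f. x I \<in> U} | I U. I \<in> D \<and> openin (X I) U}"
  have "generate_topology_on ?S W"
    using assms(1) unfolding proj_limit_def by (rule openin_topology_generated_by)
  then show ?thesis
    using assms(2)
  proof (induction arbitrary: x)
    case (Int V W)
    then obtain I U where I: "I \<in> D" "openin (X I) U" "x \<in> cylinder I U" "cylinder I U \<subseteq> V"
      by (metis IntD1)
    obtain J U' where J: "J \<in> D" "openin (X J) U'" "x \<in> cylinder J U'" "cylinder J U' \<subseteq> W"
      using Int by (metis IntD2)
    obtain K where K: "K \<in> D" "(I, K) \<in> r" "(J, K) \<in> r"
      using directed I J by blast
    define T where "T = (f K I -` U \<inter> topspace (X K)) \<inter> (f K J -` U' \<inter> topspace (X K))"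
    have "openin (X K) T"
      unfolding T_def using openin_continuous_map_preimage[OF continuous[OF K(2)] I(2)]
        openin_continuous_map_preimage[OF continuous[OF K(3)] J(2)]
      by (simp add: openin_Int vimage_def Collect_conj_eq Int_commute)
    moreover have "cylinder K T = cylinder I U \<inter> cylinder J U'"
      unfolding T_def using K by (simp add: cylinder_Int)
    ultimately show ?case
      using K(1) I J by (metis Int_iff Int_mono)
  next
    case (UN C)
    then show ?case by (meson Sup_upper Union_iff order_trans)
  next
    case (Basis s)
    then show ?case by (auto simp: cylinder_def)
  qed auto
qed

text \<open>
  For a fixed index, the union of all open cylinders over it that lie in an open set \<open>W\<close> is again an open
  cylinder. Hence \<open>W\<close> is a union of one cylinder per index, which is a countable union.
\<close>

lemma sets_proj_limit:
  assumes "countable D"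
  shows "sets (borel_of (proj_limit D r X f)) = sigma_sets (proj_limit_set D r X f) cylinders"
proof
  let ?L = "proj_limit D r X f" and ?S = "proj_limit_set D r X f"
  have top: "topspace ?L = ?S" by (rule topspace_proj_limit[OF nonempty])
  interpret C: sigma_algebra ?S "sigma_sets ?S cylinders"
    by (rule sigma_algebra_sigma_sets[OF cylinders_subset])
  have "W \<in> sigma_sets ?S cylinders" if W: "openin ?L W" for W
  proof -
    define V where "V I = \<Union>{U. openin (X I) U \<and> cylinder I U \<subseteq> W}" for I
    have V: "openin (X I) (V I)" for I
      unfolding V_def by auto
    have "W = (\<Union>I\<in>D. cylinder I (V I))"
    proof
      show "W \<subseteq> (\<Union>I\<in>D. cylinder I (V I))"
      proof
        fix x assume "x \<in> W"
        then obtain I U where "I \<in> D" "openin (X I) U" "x \<in> cylinder I U" "cylinder I U \<subseteq> W"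
          using open_contains_cylinder[OF W] by blast
        then show "x \<in> (\<Union>I\<in>D. cylinder I (V I))"
          by (auto simp: V_def cylinder_def)
      qed
      show "(\<Union>I\<in>D. cylinder I (V I)) \<subseteq> W"
        by (auto simp: V_def cylinder_def)
    qed
    also have "\<dots> \<in> sigma_sets ?S cylinders"
    proof (rule C.countable_UN'[OF assms])
      show "(\<lambda>I. cylinder I (V I)) ` D \<subseteq> sigma_sets ?S cylinders"
        using V by (auto simp: cylinders_def sets_borel_of intro!: sigma_sets.Basic)
    qed
    finally show ?thesis .
  qed
  then show "sets (borel_of ?L) \<subseteq> sigma_sets ?S cylinders"
    unfolding sets_borel_of top by (intro C.sigma_sets_subset) auto
  have "cylinder I A \<in> sets (borel_of ?L)" if "I \<in> D" "A \<in> sets (borel_of (X I))" for I A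
  proof -
    have "(\<lambda>x. x I) \<in> borel_of ?L \<rightarrow>\<^sub>M borel_of (X I)"
      by (intro measurable_borel_of_continuous continuous_map_proj_limit that)
    from measurable_sets[OF this that(2)] show ?thesis
      by (simp add: cylinder_def top vimage_def Collect_conj_eq Int_commute)
  qed
  then have "cylinders \<subseteq> sets (borel_of ?L)"
    by (auto simp: cylinders_def)
  then show "sigma_sets ?S cylinders \<subseteq> sets (borel_of ?L)"
    using sets.sigma_sets_subset[of cylinders "borel_of ?L"] by (simp add: top)
qed

lemma measurable_coordinate:
  "I \<in> D \<Longrightarrow> (\<lambda>x. x I) \<in> borel_of (proj_limit D r X f) \<rightarrow>\<^sub>M borel_of (X I)"
  by (intro measurable_borel_of_continuous continuous_map_proj_limit)

lemma emeasure_cylinder: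
  assumes "sets \<nu> = sets (borel_of (proj_limit D r X f))" "I \<in> D" "A \<in> sets (borel_of (X I))"
  shows "emeasure \<nu> (cylinder I A) = emeasure (distr \<nu> (borel_of (X I)) (\<lambda>x. x I)) A"
proof -
  have "space \<nu> = proj_limit_set D r X f"
    using sets_eq_imp_space_eq[OF assms(1)] topspace_proj_limit[OF nonempty] by simp
  moreover have "(\<lambda>x. x I) \<in> \<nu> \<rightarrow>\<^sub>M borel_of (X I)"
    using measurable_coordinate[OF assms(2)] measurable_cong_sets[OF assms(1) refl] by blast
  ultimately show ?thesis
    using assms(3)
    by (simp add: emeasure_distr cylinder_def vimage_def Collect_conj_eq Int_commute)
qed

text \<open>
  The marginals fix the measure of each cylinder, and cylinders are a generator closed under intersection.
\<close>

lemma proj_limit_measure_eqI: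
  assumes "countable D" "prob_space \<mu>"
    and sets: "sets \<mu> = sets (borel_of (proj_limit D r X f))" "sets \<nu> = sets (borel_of (proj_limit D r X f))"
    and marginals: "\<And>I. I \<in> D \<Longrightarrow>
      distr \<mu> (borel_of (X I)) (\<lambda>x. x I) = distr \<nu> (borel_of (X I)) (\<lambda>x. x I)"
  shows "\<mu> = \<nu>"
proof -
  interpret prob_space \<mu> by fact
  have "proj_limit_set D r X f \<in> cylinders"
    using nonempty cylinder_topspace sets.top[of "borel_of (X I)" for I]
    by (auto simp: cylinders_def) (metis space_borel_of)
  then show ?thesis
    using sets_proj_limit[OF assms(1)] sets Int_stable_cylinders cylinders_subset marginals
    by (intro measure_eqI_generator_eq[where E=cylinders and \<Omega>="proj_limit_set D r X f"
          and A="\<lambda>_. proj_limit_set D r X f"])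
      (auto simp: cylinders_def emeasure_cylinder)
qed

lemma measurable_into_proj_limit:
  assumes "countable D" and range: "h \<in> space N \<rightarrow> proj_limit_set D r X f"
    and coord: "\<And>I. I \<in> D \<Longrightarrow> (\<lambda>z. h z I) \<in> N \<rightarrow>\<^sub>M borel_of (X I)"
  shows "h \<in> N \<rightarrow>\<^sub>M borel_of (proj_limit D r X f)"
proof (rule measurable_sigma_sets[OF sets_proj_limit[OF assms(1)] cylinders_subset range])
  fix C assume "C \<in> cylinders"
  then obtain I A where C: "C = cylinder I A" and "I \<in> D" "A \<in> sets (borel_of (X I))"
    by (auto simp: cylinders_def)
  then have "(\<lambda>z. h z I) -` A \<inter> space N \<in> sets N"
    using coord by (auto intro: measurable_sets)
  also have "(\<lambda>z. h z I) -` A \<inter> space N = h -` C \<inter> space N"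
    using range by (auto simp: C cylinder_def)
  finally show "h -` C \<inter> space N \<in> sets N" .
qed

section \<open>Measures on the projective limit with given marginals\<close>

lemma finite_upper_bound:
  assumes "finite F" "F \<subseteq> D"
  shows "\<exists>K\<in>D. \<forall>I\<in>F. (I, K) \<in> r"
  using assms
proof (induction F)
  case empty
  then show ?case using nonempty by blast
next
  case (insert J F)
  then obtain K where K: "K \<in> D" "\<forall>I\<in>F. (I, K) \<in> r" by auto
  obtain L where "L \<in> D" "(K, L) \<in> r" "(J, L) \<in> r"
    using directed insert.prems K by (metis insert_subset)
  then show ?case using K index_order(3) by blast
qed

text \<open>
  This is Kolmogorov's extension theorem for the system. The laws \<open>Q F\<close> of finitely many coordinates are transported to
  \<open>nat \<Rightarrow> real\<close>, extended to a measure \<open>\<Lambda>\<close> on the full product, and brought back by the retractions \<open>g I\<close>.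
\<close>

lemma proj_limit_measure_exists:
  assumes D: "countable D"
    and prob: "\<And>I. I \<in> D \<Longrightarrow> prob_space (\<mu> I)"
    and sets: "\<And>I. I \<in> D \<Longrightarrow> sets (\<mu> I) = sets (borel_of (X I))"
    and consistent: "\<And>I J. (I, J) \<in> r \<Longrightarrow> distr (\<mu> J) (borel_of (X I)) (f J I) = \<mu> I"
  obtains \<nu> where "prob_space \<nu>" "sets \<nu> = sets (borel_of (proj_limit D r X f))"
    "\<And>I. I \<in> D \<Longrightarrow> distr \<nu> (borel_of (X I)) (\<lambda>x. x I) = \<mu> I"
proof -
  have space: "space (\<mu> I) = topspace (X I)" if "I \<in> D" for I
    using sets_eq_imp_space_eq[OF sets[OF that]] by simp
  have \<mu>_measurable: "(h \<in> \<mu> I \<rightarrow>\<^sub>M N) \<longleftrightarrow> (h \<in> borel_of (X I) \<rightarrow>\<^sub>M N)" if "I \<in> D"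
    for I h and N :: "'z measure"
    using measurable_cong_sets[OF sets[OF that] refl] by blast
  have "\<exists>e g. e \<in> borel_of (X I) \<rightarrow>\<^sub>M (borel :: (nat \<Rightarrow> real) measure) \<and> g \<in> borel \<rightarrow>\<^sub>M borel_of (X I) \<and>
    (\<forall>x\<in>topspace (X I). g (e x) = x)" if "I \<in> D" for I
  proof -
    have "topspace (X I) \<noteq> {}"
      using prob_space.not_empty[OF prob[OF that]] space[OF that] by simp
    then show ?thesis
      using polish_topology_measurable_retract[OF polish[OF that]] by metis
  qed
  then obtain e :: "'i \<Rightarrow> 'a \<Rightarrow> nat \<Rightarrow> real" and g
    where e: "\<And>I. I \<in> D \<Longrightarrow> e I \<in> borel_of (X I) \<rightarrow>\<^sub>M borel"
      and g: "\<And>I. I \<in> D \<Longrightarrow> g I \<in> borel \<rightarrow>\<^sub>M borel_of (X I)"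
      and ge: "\<And>I x. I \<in> D \<Longrightarrow> x \<in> topspace (X I) \<Longrightarrow> g I (e I x) = x"
    by metis
  have g_top: "g I y \<in> topspace (X I)" if "I \<in> D" for I y
    using measurable_space[OF g[OF that], of y] by simp
  have g_coord: "(\<lambda>z. g I (z I)) \<in> Pi\<^sub>M F (\<lambda>_. borel) \<rightarrow>\<^sub>M borel_of (X I)" if "I \<in> D" "I \<in> F" for I F
    using measurable_compose[OF measurable_component_singleton[of I F "\<lambda>_. borel"] g[of I]] that by simp

  (* the encoded coordinates in F, computed from a point over an upper bound K of F *)
  define \<Phi> where "\<Phi> F K x = (\<lambda>I\<in>F. e I (f K I x))" for F K x
  obtain ub where ub: "\<And>F. finite F \<Longrightarrow> F \<subseteq> D \<Longrightarrow> ub F \<in> D \<and> (\<forall>I\<in>F. (I, ub F) \<in> r)"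
    using finite_upper_bound by metis
  define Q where "Q F = distr (\<mu> (ub F)) (Pi\<^sub>M F (\<lambda>_. borel)) (\<Phi> F (ub F))" for F

  have \<Phi>: "\<Phi> F K \<in> \<mu> K \<rightarrow>\<^sub>M Pi\<^sub>M F (\<lambda>_. borel)" if "K \<in> D" "\<forall>I\<in>F. (I, K) \<in> r" for F K
    unfolding \<Phi>_def \<mu>_measurable[OF that(1)]
  proof (rule measurable_restrict)
    fix I assume "I \<in> F"
    then have "(I, K) \<in> r" "I \<in> D" using that index_order(1) by auto
    then show "(\<lambda>x. e I (f K I x)) \<in> borel_of (X K) \<rightarrow>\<^sub>M borel"
      by (intro measurable_compose[OF measurable_bonding e])
  qed
  have \<Phi>_mono: "distr (\<mu> K) (Pi\<^sub>M F (\<lambda>_. borel)) (\<Phi> F K) = distr (\<mu> L) (Pi\<^sub>M F (\<lambda>_. borel)) (\<Phi> F L)"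
    if "\<forall>I\<in>F. (I, K) \<in> r" "(K, L) \<in> r" for F K L
  proof -
    have KL: "K \<in> D" "L \<in> D" using that index_order(1) by auto
    have "distr (\<mu> K) (Pi\<^sub>M F (\<lambda>_. borel)) (\<Phi> F K) =
        distr (distr (\<mu> L) (\<mu> K) (f L K)) (Pi\<^sub>M F (\<lambda>_. borel)) (\<Phi> F K)"
      using consistent[OF that(2)] distr_cong[OF refl sets[OF KL(1)], of "\<mu> L" "f L K" "f L K"] by simp
    also have "\<dots> = distr (\<mu> L) (Pi\<^sub>M F (\<lambda>_. borel)) (\<Phi> F K \<circ> f L K)"
      using \<Phi>[OF KL(1) that(1)] measurable_bonding[OF that(2)] sets KL
      by (intro distr_distr) (simp_all cong: measurable_cong_sets)
    also have "\<dots> = distr (\<mu> L) (Pi\<^sub>M F (\<lambda>_. borel)) (\<Phi> F L)"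
      using that KL by (intro distr_cong) (auto simp: \<Phi>_def space compose[of _ K L] intro!: restrict_ext)
    finally show ?thesis .
  qed
  (* two upper bounds of F are compared through a common upper bound of both *)
  have Q: "Q F = distr (\<mu> K) (Pi\<^sub>M F (\<lambda>_. borel)) (\<Phi> F K)"
    if F: "finite F" "F \<subseteq> D" and K: "K \<in> D" "\<forall>I\<in>F. (I, K) \<in> r" for F K
  proof -
    obtain L where "(ub F, L) \<in> r" "(K, L) \<in> r"
      using directed ub[OF F] K by blast
    then show ?thesis
      unfolding Q_def using \<Phi>_mono ub[OF F] K by metis
  qed

  have restr: "distr (Q H) (Pi\<^sub>M F (\<lambda>_. borel)) (\<lambda>z. restrict z F) = Q F"
    if "F \<subseteq> H" "finite H" "H \<subseteq> D" for F H
  proof -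
    have H: "ub H \<in> D" "\<forall>I\<in>H. (I, ub H) \<in> r" using ub that by auto
    have "distr (Q H) (Pi\<^sub>M F (\<lambda>_. borel)) (\<lambda>z. restrict z F) =
        distr (\<mu> (ub H)) (Pi\<^sub>M F (\<lambda>_. borel)) ((\<lambda>z. restrict z F) \<circ> \<Phi> H (ub H))"
      unfolding Q_def using \<Phi>[OF H] that(1)
      by (intro distr_distr measurable_restrict_subset)
    also have "\<dots> = distr (\<mu> (ub H)) (Pi\<^sub>M F (\<lambda>_. borel)) (\<Phi> F (ub H))"
      using that(1) by (intro distr_cong) (auto simp: \<Phi>_def restrict_def fun_eq_iff)
    also have "\<dots> = Q F"
      using that H by (intro Q[symmetric]) (auto intro: finite_subset)
    finally show ?thesis .
  qed
  have "projective_family D Q (\<lambda>_. borel)"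
  proof (rule projective_family.intro)
    show "Q J = distr (Q H) (Pi\<^sub>M J (\<lambda>_. borel)) (\<lambda>f. restrict f J)"
      if "J \<subseteq> H" "finite H" "H \<subseteq> D" for J H
      using restr[OF that] by simp
    show "prob_space (Q J)" if "finite J" "J \<subseteq> D" for J
      unfolding Q_def using ub[OF that] by (intro prob_space.prob_space_distr prob \<Phi>) auto
  qed
  then interpret Q: polish_projective D Q
    by (simp add: polish_projective_def)
  define \<Lambda> where "\<Lambda> = Q.lim"
  have sets_\<Lambda>[measurable_cong]: "sets \<Lambda> = sets (Pi\<^sub>M D (\<lambda>_. borel))"
    by (simp add: \<Lambda>_def)
  have "prob_space \<Lambda>"
  proof
    (* the whole space is the cylinder over the empty set of coordinates *)
    have "emeasure Q.lim (Q.emb D {} (space (Pi\<^sub>M {} (\<lambda>_. borel)))) = emeasure (Q {}) (space (Pi\<^sub>M {} (\<lambda>_. borel)))"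
      by (intro Q.emeasure_lim_emb) auto
    also have "\<dots> = 1"
      using prob_space.emeasure_space_1[OF Q.prob_space_P[of "{}"]] Q.space_P[of "{}"] by simp
    also have "Q.emb D {} (space (Pi\<^sub>M {} (\<lambda>_. borel))) = space \<Lambda>"
      by (auto simp: \<Lambda>_def prod_emb_def space_PiM)
    finally show "emeasure \<Lambda> (space \<Lambda>) = 1" by (simp add: \<Lambda>_def)
  qed
  then interpret \<Lambda>: prob_space \<Lambda> .
  have \<Lambda>_marginal: "distr \<Lambda> (Pi\<^sub>M F (\<lambda>_. borel)) (\<lambda>z. restrict z F) = Q F" if F: "finite F" "F \<subseteq> D" for F
  proof (rule measure_eqI)
    fix A assume "A \<in> sets (distr \<Lambda> (Pi\<^sub>M F (\<lambda>_. borel)) (\<lambda>z. restrict z F))"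
    then have A: "A \<in> sets (Pi\<^sub>M F (\<lambda>_. borel))" by simp
    have "(\<lambda>z. restrict z F) \<in> \<Lambda> \<rightarrow>\<^sub>M Pi\<^sub>M F (\<lambda>_. borel)"
      using measurable_restrict_subset[OF F(2)] by (simp cong: measurable_cong_sets add: sets_\<Lambda>)
    then have "emeasure (distr \<Lambda> (Pi\<^sub>M F (\<lambda>_. borel)) (\<lambda>z. restrict z F)) A = emeasure Q.lim (Q.emb D F A)"
      using A by (simp add: emeasure_distr prod_emb_def \<Lambda>_def space_PiM)
    then show "emeasure (distr \<Lambda> (Pi\<^sub>M F (\<lambda>_. borel)) (\<lambda>z. restrict z F)) A = emeasure (Q F) A"
      using F A by (simp add: Q.emeasure_lim_emb)
  qed (simp add: Q.sets_P F)

  (* the points of the product that the maps g turn into elements of the projective limit *)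
  define G where "G = {z \<in> space \<Lambda>. \<forall>(I, J)\<in>r. g I (z I) = f J I (g J (z J))}"
  have r_count: "countable r"
    using index_order(1) D by (meson countable_SIGMA countable_subset)
  have G_sets_eq: "{z \<in> space (Pi\<^sub>M F (\<lambda>_. borel)). g I (z I) = f J I (g J (z J))} \<in> sets (Pi\<^sub>M F (\<lambda>_. borel))"
    if IJ: "(I, J) \<in> r" and F: "I \<in> F" "J \<in> F" for I J F
  proof -
    have IJD: "I \<in> D" "J \<in> D" using IJ index_order(1) by auto
    (* e I is injective on X I, and equality sets are measurable in the Hausdorff second countable target *)
    have "g I (z I) = f J I (g J (z J)) \<longleftrightarrow> e I (g I (z I)) = e I (f J I (g J (z J)))" for z
      using IJD IJ g_top bonding_in_topspace ge by metis
    moreover have [measurable]: "(\<lambda>z. e I (g I (z I))) \<in> Pi\<^sub>M F (\<lambda>_. borel) \<rightarrow>\<^sub>M borel"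
      using IJD F by (intro measurable_compose[OF g_coord e])
    moreover have [measurable]: "(\<lambda>z. e I (f J I (g J (z J)))) \<in> Pi\<^sub>M F (\<lambda>_. borel) \<rightarrow>\<^sub>M borel"
      using IJD F IJ by (intro measurable_compose[OF measurable_compose[OF g_coord measurable_bonding] e])
    ultimately show ?thesis by simp
  qed
  have G[measurable]: "G \<in> sets \<Lambda>"
  proof -
    have "{z \<in> space \<Lambda>. g I (z I) = f J I (g J (z J))} \<in> sets \<Lambda>" if "(I, J) \<in> r" for I J
      using G_sets_eq[OF that, of D] that index_order(1) sets_\<Lambda> sets_eq_imp_space_eq[OF sets_\<Lambda>] by auto
    then have "{z \<in> space \<Lambda>. \<forall>p\<in>r. g (fst p) (z (fst p)) = f (snd p) (fst p) (g (snd p) (z (snd p)))} \<in> sets \<Lambda>"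
      using r_count by (intro sets.sets_Collect_countable_All') auto
    then show ?thesis by (simp add: G_def case_prod_unfold)
  qed
  (* the equation depends on the coordinates I and J only, whose joint law Q {I, J} is computed over J itself *)
  have "AE z in \<Lambda>. g I (z I) = f J I (g J (z J))" if IJ: "(I, J) \<in> r" for I J
  proof -
    let ?F = "{I, J}"
    have IJD: "I \<in> D" "J \<in> D" using IJ index_order(1) by auto
    have J: "\<forall>K\<in>?F. (K, J) \<in> r" using IJ index_order(2)[OF IJD(2)] by auto
    have Q_eq: "Q ?F = distr (\<mu> J) (Pi\<^sub>M ?F (\<lambda>_. borel)) (\<Phi> ?F J)"
      using IJD J by (intro Q) auto
    have "AE x in \<mu> J. g I (\<Phi> ?F J x I) = f J I (g J (\<Phi> ?F J x J))"
      using IJ IJD by (intro AE_I2) (simp add: \<Phi>_def space ge ident bonding_in_topspace)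
    then have "AE z in Q ?F. g I (z I) = f J I (g J (z J))"
      unfolding Q_eq by (subst AE_distr_iff[OF \<Phi>[OF IJD(2) J] G_sets_eq[OF IJ]]) simp_all
    then have "AE z in distr \<Lambda> (Pi\<^sub>M ?F (\<lambda>_. borel)) (\<lambda>z. restrict z ?F). g I (z I) = f J I (g J (z J))"
      by (subst \<Lambda>_marginal) (use IJD in auto)
    moreover have "(\<lambda>z. restrict z ?F) \<in> \<Lambda> \<rightarrow>\<^sub>M Pi\<^sub>M ?F (\<lambda>_. borel)"
      using measurable_restrict_subset[of ?F D] IJD by (simp cong: measurable_cong_sets add: sets_\<Lambda>)
    ultimately show ?thesis
      using AE_distr_iff[OF _ G_sets_eq[OF IJ, of ?F], of "\<lambda>z. restrict z ?F" \<Lambda>] by simp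
  qed
  then have "AE z in \<Lambda>. \<forall>p\<in>r. g (fst p) (z (fst p)) = f (snd p) (fst p) (g (snd p) (z (snd p)))"
    using r_count by (intro AE_ball_countable') auto
  then have AE_G: "AE z in \<Lambda>. z \<in> G"
    using AE_space by eventually_elim (auto simp: G_def)
  obtain z0 where z0: "z0 \<in> G"
    using AE_G \<Lambda>.AE_False by fastforce

  (* off G the fixed point z0 of G serves as input, so that h takes all its values in the projective limit *)
  define h where "h z = (\<lambda>I\<in>D. g I ((if z \<in> G then z else z0) I))" for z
  have h_meas: "h \<in> \<Lambda> \<rightarrow>\<^sub>M borel_of (proj_limit D r X f)"
  proof (rule measurable_into_proj_limit[OF D])
    show "h \<in> space \<Lambda> \<rightarrow> proj_limit_set D r X f"
    proof
      fix z
      have "(\<lambda>I\<in>D. g I (w I)) \<in> proj_limit_set D r X f" if "w \<in> G" for w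
        using that index_order(1) by (auto simp: G_def proj_limit_set_def g_top)
      then show "h z \<in> proj_limit_set D r X f"
        using z0 by (simp add: h_def)
    qed
    show "(\<lambda>z. h z I) \<in> \<Lambda> \<rightarrow>\<^sub>M borel_of (X I)" if "I \<in> D" for I
    proof -
      have "(\<lambda>z. z I) \<in> \<Lambda> \<rightarrow>\<^sub>M borel"
        using that by measurable
      then have "(\<lambda>z. if z \<in> G then z I else z0 I) \<in> \<Lambda> \<rightarrow>\<^sub>M borel"
        by measurable
      from measurable_compose[OF this g[OF that]] show ?thesis
        using that by (simp add: h_def if_distrib[of "\<lambda>z. z I"] cong: if_cong)
    qed
  qed
  show thesis
  proof
    show "prob_space (distr \<Lambda> (borel_of (proj_limit D r X f)) h)"
      by (rule \<Lambda>.prob_space_distr[OF h_meas])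
    show "distr (distr \<Lambda> (borel_of (proj_limit D r X f)) h) (borel_of (X I)) (\<lambda>x. x I) = \<mu> I"
      if I: "I \<in> D" for I
    proof -
      have II: "\<forall>K\<in>{I}. (K, I) \<in> r" using index_order(2)[OF I] by simp
      have r_meas: "(\<lambda>z. restrict z {I}) \<in> \<Lambda> \<rightarrow>\<^sub>M Pi\<^sub>M {I} (\<lambda>_. borel)"
        using measurable_restrict_subset[of "{I}" D] I by (simp cong: measurable_cong_sets add: sets_\<Lambda>)
      have gI: "(\<lambda>z. g I (z I)) \<in> Pi\<^sub>M {I} (\<lambda>_. borel) \<rightarrow>\<^sub>M borel_of (X I)"
        using I by (intro g_coord) auto
      have "distr (distr \<Lambda> (borel_of (proj_limit D r X f)) h) (borel_of (X I)) (\<lambda>x. x I) =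
          distr \<Lambda> (borel_of (X I)) ((\<lambda>x. x I) \<circ> h)"
        by (rule distr_distr[OF measurable_coordinate[OF I] h_meas])
      also have "\<dots> = distr \<Lambda> (borel_of (X I)) ((\<lambda>z. g I (z I)) \<circ> (\<lambda>z. restrict z {I}))"
      proof (rule distr_cong_AE)
        show "AE z in \<Lambda>. ((\<lambda>x. x I) \<circ> h) z = ((\<lambda>z. g I (z I)) \<circ> (\<lambda>z. restrict z {I})) z"
          using AE_G by eventually_elim (simp add: h_def I)
      qed (use measurable_comp[OF h_meas measurable_coordinate[OF I]] measurable_comp[OF r_meas gI] in auto)
      also have "\<dots> = distr (Q {I}) (borel_of (X I)) (\<lambda>z. g I (z I))"
        using \<Lambda>_marginal[of "{I}"] I distr_distr[OF gI r_meas] by simp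
      also have "\<dots> = distr (\<mu> I) (borel_of (X I)) ((\<lambda>z. g I (z I)) \<circ> \<Phi> {I} I)"
        using Q[of "{I}" I] I II distr_distr[OF gI \<Phi>[OF I II]] by simp
      also have "\<dots> = distr (\<mu> I) (\<mu> I) (\<lambda>x. x)"
        using I sets by (intro distr_cong) (auto simp: \<Phi>_def space ident ge)
      finally show ?thesis by simp
    qed
  qed simp
qed

end

section \<open>The limit kernel\<close>

theorem theorem1:
  fixes M :: "'w measure"
    and D :: "'i set" and r :: "('i \<times> 'i) set"
    and X :: "'i \<Rightarrow> 'a topology" and f :: "'i \<Rightarrow> 'i \<Rightarrow> 'a \<Rightarrow> 'a"
    and C :: "'i \<Rightarrow> 'w measure"
    and Y :: "'i \<Rightarrow> 'w \<Rightarrow> 'a"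
    and P :: "'i \<Rightarrow> 'w \<Rightarrow> 'a measure"
  assumes "prob_space M"
    and "countable D"
    and "projective_system D r X f"
    and "\<And>I. I \<in> D \<Longrightarrow> subalgebra M (C I)"
    and "\<And>I J. (I, J) \<in> r \<Longrightarrow> sets (C I) \<subseteq> sets (C J)"
    and "\<And>I. I \<in> D \<Longrightarrow> Y I \<in> M \<rightarrow>\<^sub>M borel_of (X I)"
    and "\<And>I. I \<in> D \<Longrightarrow> regular_cond_prob M (C I) (borel_of (X I)) (Y I) (P I)"
    and "\<And>I J. (I, J) \<in> r \<Longrightarrow> AE \<omega> in M. distr (P J \<omega>) (borel_of (X I)) (f J I) = P I \<omega>"
  shows "\<exists>\<kappa>. limit_kernel M C D r X f P \<kappa> \<and>
    (\<forall>\<kappa>'. limit_kernel M C D r X f P \<kappa>' \<longrightarrow> (AE \<omega> in M. \<kappa>' \<omega> = \<kappa> \<omega>))"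
proof -
  interpret prob_space M by fact
  interpret projective_system D r X f by fact
  let ?L = "borel_of (proj_limit D r X f)"
  define CD where "CD = sigma (space M) (\<Union>I\<in>D. sets (C I))"
  have sub: "space (C I) = space M" "sets (C I) \<subseteq> sets M" if "I \<in> D" for I
    using assms(4)[OF that] by (auto simp: subalgebra_def)
  have Pow: "(\<Union>I\<in>D. sets (C I)) \<subseteq> Pow (space M)"
    using sub sets.sets_into_space by blast
  have space_CD: "space CD = space M" and sets_CD: "sets CD = sigma_sets (space M) (\<Union>I\<in>D. sets (C I))"
    using Pow by (simp_all add: CD_def)
  have C_CD: "subalgebra CD (C I)" if "I \<in> D" for I
    unfolding subalgebra_def using that sub sets_CD space_CD by auto
  have P: "P I \<in> CD \<rightarrow>\<^sub>M prob_algebra (borel_of (X I))" if "I \<in> D" for I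
    using assms(7)[OF that] by (intro measurable_from_subalg[OF C_CD[OF that]]) (simp add: regular_cond_prob_def)
  have r_count: "countable r"
    using index_order(1) assms(2) by (meson countable_SIGMA countable_subset)

  (* the points at which all pairs of marginals are consistent *)
  define G where "G = {\<omega> \<in> space CD. \<forall>p\<in>r. distr (P (snd p) \<omega>) (borel_of (X (fst p))) (f (snd p) (fst p)) = P (fst p) \<omega>}"
  have G: "G \<in> sets CD"
    unfolding G_def
  proof (intro sets.sets_Collect_countable_All' r_count)
    fix p assume "p \<in> r"
    then obtain I J where p: "p = (I, J)" "(I, J) \<in> r" by (cases p) auto
    then have IJ: "I \<in> D" "J \<in> D" using index_order(1) by auto
    show "{\<omega> \<in> space CD. distr (P (snd p) \<omega>) (borel_of (X (fst p))) (f (snd p) (fst p)) = P (fst p) \<omega>} \<in> sets CD"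
      using measurable_eq_prob_kernels[OF polish[OF IJ(1)]
        measurable_compose[OF P[OF IJ(2)] measurable_distr_prob_space[OF measurable_bonding[OF p(2)]]] P[OF IJ(1)]]
      by (simp add: p)
  qed
  have "AE \<omega> in M. \<forall>p\<in>r. distr (P (snd p) \<omega>) (borel_of (X (fst p))) (f (snd p) (fst p)) = P (fst p) \<omega>"
    using assms(8) r_count by (intro AE_ball_countable') auto
  then have AE_G: "AE \<omega> in M. \<omega> \<in> G"
    using AE_space by eventually_elim (auto simp: G_def space_CD)
  obtain \<omega>0 where \<omega>0: "\<omega>0 \<in> G"
    using AE_G AE_False by fastforce

  have "\<exists>\<nu>. prob_space \<nu> \<and> sets \<nu> = sets ?L \<and> (\<forall>I\<in>D. distr \<nu> (borel_of (X I)) (\<lambda>x. x I) = P I \<omega>)"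
    if "\<omega> \<in> G" for \<omega>
  proof -
    have "P I \<omega> \<in> space (prob_algebra (borel_of (X I)))" if "I \<in> D" for I
      using measurable_space[OF P[OF that]] \<open>\<omega> \<in> G\<close> by (auto simp: G_def)
    moreover have "distr (P J \<omega>) (borel_of (X I)) (f J I) = P I \<omega>" if "(I, J) \<in> r" for I J
      using \<open>\<omega> \<in> G\<close> that by (auto simp: G_def)
    ultimately show ?thesis
      using proj_limit_measure_exists[OF assms(2), of "\<lambda>I. P I \<omega>"]
      by (simp add: space_prob_algebra) metis
  qed
  then obtain \<nu> where \<nu>: "\<And>\<omega>. \<omega> \<in> G \<Longrightarrow> prob_space (\<nu> \<omega>)" "\<And>\<omega>. \<omega> \<in> G \<Longrightarrow> sets (\<nu> \<omega>) = sets ?L"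
    and \<nu>_marginal: "\<And>\<omega> I. \<omega> \<in> G \<Longrightarrow> I \<in> D \<Longrightarrow> distr (\<nu> \<omega>) (borel_of (X I)) (\<lambda>x. x I) = P I \<omega>"
    by metis
  (* inconsistent points are replaced by one consistent point, which keeps \<kappa> measurable and defined everywhere *)
  define h where "h \<omega> = (if \<omega> \<in> G then \<omega> else \<omega>0)" for \<omega>
  have hG: "h \<omega> \<in> G" for \<omega> using \<omega>0 by (simp add: h_def)
  have h: "h \<in> CD \<rightarrow>\<^sub>M CD"
    unfolding h_def using G \<omega>0 by (intro measurable_If_set) (auto simp: G_def)
  define \<kappa> where "\<kappa> \<omega> = \<nu> (h \<omega>)" for \<omega>

  have "\<kappa> \<in> CD \<rightarrow>\<^sub>M prob_algebra ?L"
  proof (rule measurable_prob_algebra_generated[OF sets_proj_limit[OF assms(2)] Int_stable_cylinders cylinders_subset])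
    fix A assume "A \<in> cylinders"
    then obtain I B where A: "A = cylinder I B" and I: "I \<in> D" and B: "B \<in> sets (borel_of (X I))"
      by (auto simp: cylinders_def)
    have "(\<lambda>\<omega>. emeasure (P I (h \<omega>)) B) \<in> borel_measurable CD"
      using measurable_compose[OF h measurable_emeasure_kernel[OF measurable_prob_algebraD[OF P[OF I]] B]] .
    then show "(\<lambda>\<omega>. emeasure (\<kappa> \<omega>) A) \<in> borel_measurable CD"
      using I B hG by (simp add: A \<kappa>_def emeasure_cylinder \<nu> \<nu>_marginal)
  qed (simp_all add: \<kappa>_def \<nu> hG)
  moreover have "AE \<omega> in M. distr (\<kappa> \<omega>) (borel_of (X I)) (\<lambda>x. x I) = P I \<omega>" if "I \<in> D" for I
    using AE_G by eventually_elim (simp add: \<kappa>_def h_def \<nu>_marginal that)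
  ultimately have \<kappa>: "limit_kernel M C D r X f P \<kappa>"
    by (simp add: limit_kernel_def CD_def)

  have "AE \<omega> in M. \<kappa>' \<omega> = \<kappa> \<omega>" if "limit_kernel M C D r X f P \<kappa>'" for \<kappa>'
  proof -
    have lk: "K \<in> CD \<rightarrow>\<^sub>M prob_algebra ?L"
      "AE \<omega> in M. \<forall>I\<in>D. distr (K \<omega>) (borel_of (X I)) (\<lambda>x. x I) = P I \<omega>"
      if "limit_kernel M C D r X f P K" for K
      using that assms(2) by (auto simp: limit_kernel_def CD_def intro: AE_ball_countable')
    show ?thesis
      using lk(2)[OF \<kappa>] lk(2)[OF that] AE_space
    proof eventually_elim
      fix \<omega> assume *: "\<forall>I\<in>D. distr (\<kappa> \<omega>) (borel_of (X I)) (\<lambda>x. x I) = P I \<omega>"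
        "\<forall>I\<in>D. distr (\<kappa>' \<omega>) (borel_of (X I)) (\<lambda>x. x I) = P I \<omega>" "\<omega> \<in> space M"
      have "\<kappa> \<omega> \<in> space (prob_algebra ?L)" "\<kappa>' \<omega> \<in> space (prob_algebra ?L)"
        using measurable_space[OF lk(1)[OF \<kappa>]] measurable_space[OF lk(1)[OF that]] * by (auto simp: space_CD)
      then show "\<kappa>' \<omega> = \<kappa> \<omega>"
        using * by (intro proj_limit_measure_eqI[OF assms(2)]) (auto simp: space_prob_algebra)
    qed
  qed
  with \<kappa> show ?thesis by blast
qed

end
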